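(* Let $\mathbb{K}\in\{\mathbb{R},\mathbb{C}\}$, let $A\in\mathbb{K}^{M\times N}$ and $B_1,\dots,B_N\in\mathbb{K}^{m\times n}$, and let $\mathcal{H}$ be the hierarchical measurement operator defined by $A$ and $(B_i)_{i=1}^N$. Then for arbitrary positive integers $s,\sigma$, $$\delta_{s,\sigma}(\mathcal{H})\le\delta_s(A)+\sup_i\delta_\sigma(B_i)+\delta_s(A)\cdot\sup_i\delta_\sigma(B_i).$$
   Context: Let $\|\cdot\|$ be the Euclidean norm. A vector $x\in\mathbb{K}^N\otimes\mathbb{K}^n\cong\mathbb{K}^{Nn}$ with blocks $x_1,\dots,x_N\in\mathbb{K}^n$ is written $x=\sum_{i=1}^Ne_i\otimes x_i$ with $e_i$ the standard basis of $\mathbb{K}^N$. It is $(s,\sigma)$-sparse if at most $s$ of the blocks are non-zero and each non-zero block has at most $\sigma$ non-zero entries. The hierarchical measurement operator defined by $A$ (with columns $a_1,\dots,a_N\in\mathbb{K}^M$) and $(B_i)_{i=1}^N$ is $$\mathcal{H}:\mathbb{K}^N\otimes\mathbb{K}^n\to\mathbb{K}^M\otimes\mathbb{K}^m,\qquad x\mapsto\sum_{i=1}^Na_i\otimes(B_ix_i).$$ For a matrix $B$, $\delta_k(B)$ is the smallest $\delta\ge0$ with $(1-\delta)\|v\|^2\le\|Bv\|^2\le(1+\delta)\|v\|^2$ for all $k$-sparse $v$ (at most $k$ non-zero entries). $\delta_{s,\sigma}(\mathcal{H})$ is the smallest $\delta\ge0$ with $(1-\delta)\|x\|^2\le\|\mathcal{H}(x)\|^2\le(1+\delta)\|x\|^2$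 for all $(s,\sigma)$-sparse $x$. *)

theory Defs
  imports "HOL-Analysis.Analysis"
begin

(* A tensor in K^N (x) K^n is stored as its family of blocks, of type 'a ^ 'n ^ 'N.
   The library norm on this iterated vector type is the Euclidean norm of all N * n entries
   (norm_blocks_sq), and the blocks are the x_i in x = sum_i e_i (x) x_i (blocks_decomp). *)

definition tensor_vec :: "'a::times ^ 'N \<Rightarrow> 'a ^ 'n \<Rightarrow> 'a ^ 'n ^ 'N" (infixr "\<otimes>\<^sub>v" 75)
  where "u \<otimes>\<^sub>v v = (\<chi> i j. u $ i * v $ j)"

definition sparse_vec :: "nat \<Rightarrow> 'a::zero ^ 'n \<Rightarrow> bool"
  where "sparse_vec k v \<longleftrightarrow> card {j. v $ j \<noteq> 0} \<le> k"

definition hi_sparse :: "nat \<Rightarrow> nat \<Rightarrow> 'a::zero ^ 'n ^ 'N \<Rightarrow> bool"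
  where "hi_sparse s \<sigma> x \<longleftrightarrow>
    card {i. x $ i \<noteq> 0} \<le> s \<and> (\<forall>i. x $ i \<noteq> 0 \<longrightarrow> sparse_vec \<sigma> (x $ i))"

definition hi_op ::
    "'a::real_normed_field ^ 'N ^ 'M \<Rightarrow> ('N \<Rightarrow> 'a ^ 'n ^ 'm) \<Rightarrow> 'a ^ 'n ^ 'N \<Rightarrow> 'a ^ 'm ^ 'M"
  where "hi_op A B x = (\<Sum>i\<in>UNIV. column i A \<otimes>\<^sub>v (B i *v (x $ i)))"

definition ric :: "nat \<Rightarrow> 'a::real_normed_field ^ 'n ^ 'm \<Rightarrow> real"
  where "ric k B = (LEAST \<delta>. 0 \<le> \<delta> \<and> (\<forall>v. sparse_vec k v \<longrightarrow>
    (1 - \<delta>) * (norm v)\<^sup>2 \<le> (norm (B *v v))\<^sup>2 \<and>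
    (norm (B *v v))\<^sup>2 \<le> (1 + \<delta>) * (norm v)\<^sup>2))"

definition hi_ric ::
    "nat \<Rightarrow> nat \<Rightarrow> ('a::real_normed_field ^ 'n ^ 'N \<Rightarrow> 'a ^ 'm ^ 'M) \<Rightarrow> real"
  where "hi_ric s \<sigma> H = (LEAST \<delta>. 0 \<le> \<delta> \<and> (\<forall>x. hi_sparse s \<sigma> x \<longrightarrow>
    (1 - \<delta>) * (norm x)\<^sup>2 \<le> (norm (H x))\<^sup>2 \<and>
    (norm (H x))\<^sup>2 \<le> (1 + \<delta>) * (norm x)\<^sup>2))"

lemma norm_blocks_sq:
  fixes x :: "'a::real_normed_field ^ 'n ^ 'N"
  shows "(norm x)\<^sup>2 = (\<Sum>i\<in>UNIV. \<Sum>j\<in>UNIV. (norm (x $ i $ j))\<^sup>2)"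
  by (simp add: norm_vec_def L2_set_def sum_nonneg)

lemma blocks_decomp:
  fixes x :: "'a::real_normed_field ^ 'n ^ 'N"
  shows "x = (\<Sum>i\<in>UNIV. axis i 1 \<otimes>\<^sub>v (x $ i))"
  by (simp add: vec_eq_iff tensor_vec_def axis_def if_distrib[of "\<lambda>c. c * _"] cong: if_cong)

(* The minimum in the definitions of ric and hi_ric is attained for every bounded map,
   so LEAST is meaningful there. *)
lemma ric_set_has_least:
  fixes f :: "'v::real_normed_vector \<Rightarrow> 'w::real_normed_vector" and S :: "'v \<Rightarrow> bool"
  assumes bdd: "\<And>v. norm (f v) \<le> C * norm v"
  defines "P \<equiv> \<lambda>\<delta>. 0 \<le> \<delta> \<and> (\<forall>v. S v \<longrightarrow>
    (1 - \<delta>) * (norm v)\<^sup>2 \<le> (norm (f v))\<^sup>2 \<and> (norm (f v))\<^sup>2 \<le> (1 + \<delta>) * (norm v)\<^sup>2)"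
  shows "P (LEAST \<delta>. P \<delta>)" and "P \<delta> \<Longrightarrow> (LEAST \<delta>. P \<delta>) \<le> \<delta>"
proof -
  have cl: "closed {\<delta>. P \<delta>}"
    unfolding P_def
    by (intro closed_Collect_conj closed_Collect_all closed_Collect_imp closed_Collect_le
        continuous_intros) auto
  have "P (1 + C\<^sup>2)"
    unfolding P_def
  proof (intro conjI allI impI)
    fix v
    have "(norm (f v))\<^sup>2 \<le> C\<^sup>2 * (norm v)\<^sup>2"
      using power_mono[OF bdd[of v], of 2] by (simp add: power_mult_distrib)
    also have "\<dots> \<le> (1 + (1 + C\<^sup>2)) * (norm v)\<^sup>2"
      by (intro mult_right_mono) auto
    finally show "(norm (f v))\<^sup>2 \<le> (1 + (1 + C\<^sup>2)) * (norm v)\<^sup>2" .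
    have "(1 - (1 + C\<^sup>2)) * (norm v)\<^sup>2 \<le> 0"
      by (simp add: mult_nonpos_nonneg)
    then show "(1 - (1 + C\<^sup>2)) * (norm v)\<^sup>2 \<le> (norm (f v))\<^sup>2"
      by (rule order_trans) simp
  qed simp
  then have ne: "{\<delta>. P \<delta>} \<noteq> {}" by blast
  have bb: "bdd_below {\<delta>. P \<delta>}" by (auto simp: P_def intro: bdd_belowI[of _ 0])
  have "Inf {\<delta>. P \<delta>} \<in> {\<delta>. P \<delta>}"
    by (rule closed_contains_Inf[OF ne bb cl])
  moreover have "Inf {\<delta>. P \<delta>} \<le> \<delta>" if "P \<delta>" for \<delta>
    using that by (intro cInf_lower[OF _ bb]) simp
  ultimately have L: "P (Inf {\<delta>. P \<delta>})" "(LEAST \<delta>. P \<delta>) = Inf {\<delta>. P \<delta>}"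
    by (auto intro: Least_equality)
  then show "P (LEAST \<delta>. P \<delta>)" by simp
  show "P \<delta> \<Longrightarrow> (LEAST \<delta>. P \<delta>) \<le> \<delta>"
    using L cInf_lower[OF _ bb] by simp
qed

end

theory Submission
  imports Defs
begin

text \<open>
  Slicing the output block array along the coordinates \<open>k\<close> of the second tensor factor gives
  \<open>\<parallel>\<H> x\<parallel>\<^sup>2 = (\<Sum>k. \<parallel>A w\<^sub>k\<parallel>\<^sup>2)\<close>, where \<open>w\<^sub>k\<close> collects the \<open>k\<close>-th entries of the vectors
  \<open>B\<^sub>i x\<^sub>i\<close>. Each \<open>w\<^sub>k\<close> is \<open>s\<close>-sparse when \<open>x\<close> has at most \<open>s\<close> non-zero blocks, so the restricted
  isometry property of \<open>A\<close> compares the sum with \<open>(\<Sum>i. \<parallel>B\<^sub>i x\<^sub>i\<parallel>\<^sup>2)\<close>, and those of the \<open>B\<^sub>i\<close>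
  compare this with \<open>\<parallel>x\<parallel>\<^sup>2\<close>.
\<close>

lemma norm_vec_sq:
  fixes x :: "'a::real_normed_vector ^ 'n"
  shows "(norm x)\<^sup>2 = (\<Sum>i\<in>UNIV. (norm (x $ i))\<^sup>2)"
  by (simp add: norm_vec_def L2_set_def sum_nonneg)

text \<open>Boundedness comes from finite dimension, via \<open>euclidean_space\<close>; it is what
  makes the \<open>LEAST\<close> in \<open>hi_ric\<close> an attained minimum.\<close>

lemma bounded_linear_hi_op:
  fixes A :: "'a::{real_normed_field, euclidean_space} ^ 'N ^ 'M" and B :: "'N \<Rightarrow> 'a ^ 'n ^ 'm"
  shows "bounded_linear (hi_op A B)"
proof -
  have "linear (hi_op A B)"
    by (rule linearI)
      (simp_all add: hi_op_def tensor_vec_def vec_eq_iff matrix_vector_mult_def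
        sum.distrib distrib_left scaleR_sum_right sum_distrib_left)
  then show ?thesis
    by (simp add: linear_conv_bounded_linear)
qed

text \<open>Matrices act as bounded maps, so the minimum defining \<open>ric\<close> is attained and
  is itself an admissible constant.\<close>

lemma
  fixes B :: "'a::{real_normed_field, euclidean_space} ^ 'n ^ 'm"
  shows ric_nonneg: "0 \<le> ric k B"
    and ric_lower: "sparse_vec k v \<Longrightarrow> (1 - ric k B) * (norm v)\<^sup>2 \<le> (norm (B *v v))\<^sup>2"
    and ric_upper: "sparse_vec k v \<Longrightarrow> (norm (B *v v))\<^sup>2 \<le> (1 + ric k B) * (norm v)\<^sup>2"
proof -
  obtain C where C: "\<And>v. norm (B *v v) \<le> C * norm v"
    using bounded_linear.pos_bounded[OF matrix_vector_mul_bounded_linear[of B]]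
    by (metis mult.commute)
  note * = ric_set_has_least(1)[of "(*v) B" C "sparse_vec k", OF C, folded ric_def]
  show "0 \<le> ric k B"
    and "sparse_vec k v \<Longrightarrow> (1 - ric k B) * (norm v)\<^sup>2 \<le> (norm (B *v v))\<^sup>2"
    and "sparse_vec k v \<Longrightarrow> (norm (B *v v))\<^sup>2 \<le> (1 + ric k B) * (norm v)\<^sup>2"
    using * by blast+
qed

lemma hi_ric_le:
  fixes A :: "'a::{real_normed_field, euclidean_space} ^ 'N ^ 'M" and B :: "'N \<Rightarrow> 'a ^ 'n ^ 'm"
  assumes "0 \<le> \<delta>"
    and "\<And>x. hi_sparse s \<sigma> x \<Longrightarrow> (1 - \<delta>) * (norm x)\<^sup>2 \<le> (norm (hi_op A B x))\<^sup>2"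
    and "\<And>x. hi_sparse s \<sigma> x \<Longrightarrow> (norm (hi_op A B x))\<^sup>2 \<le> (1 + \<delta>) * (norm x)\<^sup>2"
  shows "hi_ric s \<sigma> (hi_op A B) \<le> \<delta>"
proof -
  obtain C where C: "\<And>x. norm (hi_op A B x) \<le> C * norm x"
    using bounded_linear.pos_bounded[OF bounded_linear_hi_op[of A B]] by (metis mult.commute)
  show ?thesis
    unfolding hi_ric_def
    by (rule ric_set_has_least(2)[of "hi_op A B" C, OF C]) (use assms in blast)
qed

lemma norm_hi_op_sq:
  fixes A :: "'a::real_normed_field ^ 'N ^ 'M" and B :: "'N \<Rightarrow> 'a ^ 'n ^ 'm"
  shows "(norm (hi_op A B x))\<^sup>2 = (\<Sum>k\<in>UNIV. (norm (A *v (\<chi> i. (B i *v (x $ i)) $ k)))\<^sup>2)"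
proof -
  have "hi_op A B x $ j $ k = (A *v (\<chi> i. (B i *v (x $ i)) $ k)) $ j" for j k
    by (simp add: hi_op_def tensor_vec_def column_def matrix_vector_mult_def[of A])
  then have "(norm (hi_op A B x))\<^sup>2
      = (\<Sum>j\<in>UNIV. \<Sum>k\<in>UNIV. (norm ((A *v (\<chi> i. (B i *v (x $ i)) $ k)) $ j))\<^sup>2)"
    by (simp add: norm_blocks_sq)
  also have "\<dots> = (\<Sum>k\<in>UNIV. (norm (A *v (\<chi> i. (B i *v (x $ i)) $ k)))\<^sup>2)"
    by (subst sum.swap) (simp add: norm_vec_sq)
  finally show ?thesis .
qed

lemma sum_norm_slices_sq:
  fixes y :: "'N::finite \<Rightarrow> 'a::real_normed_vector ^ 'm"
  shows "(\<Sum>k\<in>UNIV. (norm (\<chi> i. y i $ k))\<^sup>2) = (\<Sum>i\<in>UNIV. (norm (y i))\<^sup>2)"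
  by (simp add: norm_vec_sq) (rule sum.swap)

text \<open>The sort covers both \<open>real\<close> and \<open>complex\<close>, so one proof serves
  both fields.\<close>

lemma hi_ric_hi_op_le:
  fixes A :: "'a::{real_normed_field, euclidean_space} ^ 'N ^ 'M" and B :: "'N \<Rightarrow> 'a ^ 'n ^ 'm"
  shows "hi_ric s \<sigma> (hi_op A B)
    \<le> ric s A + (SUP i. ric \<sigma> (B i)) + ric s A * (SUP i. ric \<sigma> (B i))"
proof -
  define a where "a = ric s A"
  define b where "b = (SUP i. ric \<sigma> (B i))"
  \<comment> \<open>The index type is finite, so the supremum is over a bounded set.\<close>
  have le_b: "ric \<sigma> (B i) \<le> b" for i
    unfolding b_def by (intro cSUP_upper) auto
  have a: "0 \<le> a"
    by (simp add: a_def ric_nonneg)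
  have b: "0 \<le> b"
    using ric_nonneg le_b by (rule order_trans)
  have "hi_ric s \<sigma> (hi_op A B) \<le> a + b + a * b"
  proof (rule hi_ric_le)
    show "0 \<le> a + b + a * b"
      using a b by simp
    fix x :: "'a ^ 'n ^ 'N"
    assume x: "hi_sparse s \<sigma> x"
    define w where "w = (\<lambda>k. \<chi> i. (B i *v (x $ i)) $ k)"
    define S where "S = (\<Sum>i\<in>UNIV. (norm (B i *v (x $ i)))\<^sup>2)"
    have sparse_w: "sparse_vec s (w k)" for k
    proof -
      \<comment> \<open>A zero block \<open>x $ i\<close> gives \<open>B i *v (x $ i) = 0\<close>,
        so entry \<open>i\<close> vanishes in every slice.\<close>
      have "card {i. w k $ i \<noteq> 0} \<le> card {i. x $ i \<noteq> 0}"
        by (intro card_mono) (auto simp: w_def)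
      with x show ?thesis
        by (simp add: hi_sparse_def sparse_vec_def)
    qed
    \<comment> \<open>\<open>hi_sparse\<close> constrains only non-zero blocks; a zero block has
      empty support.\<close>
    have sparse_x: "sparse_vec \<sigma> (x $ i)" for i
      using x by (cases "x $ i = 0") (auto simp: hi_sparse_def sparse_vec_def)
    have H: "(norm (hi_op A B x))\<^sup>2 = (\<Sum>k\<in>UNIV. (norm (A *v w k))\<^sup>2)"
      by (simp add: norm_hi_op_sq w_def)
    have S: "(\<Sum>k\<in>UNIV. (norm (w k))\<^sup>2) = S"
      by (simp add: w_def S_def sum_norm_slices_sq)
    have A_lower: "(1 - a) * S \<le> (norm (hi_op A B x))\<^sup>2"
      unfolding H S[symmetric] sum_distrib_left a_def
      by (intro sum_mono ric_lower sparse_w)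
    have A_upper: "(norm (hi_op A B x))\<^sup>2 \<le> (1 + a) * S"
      unfolding H S[symmetric] sum_distrib_left a_def
      by (intro sum_mono ric_upper sparse_w)
    have B_lower: "(1 - b) * (norm x)\<^sup>2 \<le> S"
      unfolding S_def norm_vec_sq[of x] sum_distrib_left
      by (intro sum_mono order_trans[OF mult_right_mono ric_lower[OF sparse_x]])
        (simp_all add: le_b)
    have B_upper: "S \<le> (1 + b) * (norm x)\<^sup>2"
      unfolding S_def norm_vec_sq[of x] sum_distrib_left
      by (intro sum_mono order_trans[OF ric_upper[OF sparse_x] mult_right_mono])
        (simp_all add: le_b)
    \<comment> \<open>The constant comes from here:
      \<open>(1 + a) * (1 + b) = 1 + (a + b + a * b)\<close>.\<close>
    show "(norm (hi_op A B x))\<^sup>2 \<le> (1 + (a + b + a * b)) * (norm x)\<^sup>2"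
      using order_trans[OF A_upper mult_left_mono[OF B_upper]] a by (simp add: algebra_simps)
    show "(1 - (a + b + a * b)) * (norm x)\<^sup>2 \<le> (norm (hi_op A B x))\<^sup>2"
    \<comment> \<open>Multiplying \<open>B_lower\<close> by \<open>1 - a\<close> needs
      \<open>1 - a\<close> non-negative; if \<open>a > 1\<close>, the left-hand side of the goal is
      at most 0.\<close>
    proof (cases "a \<le> 1")
      case True
      \<comment> \<open>The two factors differ by \<open>2 * a * b\<close>, which is
        non-negative.\<close>
      have "(1 - (a + b + a * b)) * (norm x)\<^sup>2 \<le> ((1 - a) * (1 - b)) * (norm x)\<^sup>2"
        using a b by (intro mult_right_mono) (simp_all add: algebra_simps)
      also have "\<dots> \<le> (1 - a) * S"
        using mult_left_mono[OF B_lower, of "1 - a"] True by (simp add: mult.assoc)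
      finally show ?thesis
        using A_lower by simp
    next
      case False
      then have "1 - (a + b + a * b) \<le> 0"
        using a b by (simp add: add_increasing2)
      then have "(1 - (a + b + a * b)) * (norm x)\<^sup>2 \<le> 0"
        by (simp add: mult_nonpos_nonneg)
      then show ?thesis
        by (rule order_trans) simp
    qed
  qed
  then show ?thesis
    by (simp add: a_def b_def)
qed

theorem theorem4:
  fixes s \<sigma> :: nat
  assumes "s > 0" and "\<sigma> > 0"
  shows
    "(\<forall>(A :: real ^ 'N ^ 'M) (B :: 'N \<Rightarrow> real ^ 'n ^ 'm).
        hi_ric s \<sigma> (hi_op A B) \<le> ric s A + (SUP i. ric \<sigma> (B i)) + ric s A * (SUP i. ric \<sigma> (B i))) \<and>
     (\<forall>(A :: complex ^ 'N ^ 'M) (B :: 'N \<Rightarrow> complex ^ 'n ^ 'm).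
        hi_ric s \<sigma> (hi_op A B) \<le> ric s A + (SUP i. ric \<sigma> (B i)) + ric s A * (SUP i. ric \<sigma> (B i)))"
  by (intro conjI allI hi_ric_hi_op_le)

end
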